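(* Let $f(X)$ be a non-constant polynomial with integer coefficients which has no roots in some sector $S_{v,\theta}$ with $v\in\mathbb{R}$ and $0<\theta\le\frac{\pi}{2}$. Assume that $f(m)=p^kq$ and $f'(m)=\pm p^{\ell}r$ with $p$ a prime number, $k,q,r,m$ positive integers, $\ell$ a non-negative integer, and $p\nmid qr$. Let $s:=\min(\ell,\frac{k}{2})$. If $m>v+\frac{p^sq}{\sin\theta}$, then $f$ is irreducible over $\mathbb{Q}$. Moreover, if $f$ has no rational roots, the same conclusion holds if $m>v+\frac{\sqrt{p^sq}}{\sin\theta}$ (in place of $m>v+\frac{p^sq}{\sin\theta}$).
   Context: For real numbers $v,\theta$ with $0<\theta<\pi$, define the open sector $S_{v,\theta}=\{z=v+\rho e^{i\varphi}\in\mathbb{C}:\rho>0,\ |\varphi|<\theta\}$ (with $\varphi$ real). Here $f'$ denotes the derivative of $f$. *)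

theory Defs
  imports Complex_Main "HOL-Computational_Algebra.Computational_Algebra"
begin

definition open_sector :: "real \<Rightarrow> real \<Rightarrow> complex set" where
  "open_sector v \<theta> =
     {of_real v + of_real \<rho> * exp (\<i> * of_real \<phi>) | \<rho> \<phi> :: real. \<rho> > 0 \<and> \<bar>\<phi>\<bar> < \<theta>}"

end

theory Submission
  imports Defs
begin

text \<open>
  If \<open>f = g h\<close> over \<open>\<int>\<close>, then \<open>f m = g m * h m\<close> and \<open>f' m = g' m * h m + g m * h' m\<close>. With
  \<open>a\<close> the smaller of the exponents of \<open>p\<close> in \<open>g m\<close> and \<open>h m\<close>, both \<open>2 a \<le> k\<close> and \<open>a \<le> l\<close>, so one
  of the two values is at most \<open>p\<^sup>s q\<close> in absolute value. On the other hand every complex root of \<open>f\<close>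
  has distance at least \<open>(m - v) sin \<theta>\<close> from \<open>m\<close>, so a factor of degree \<open>n\<close> is at least
  \<open>((m - v) sin \<theta>)\<^sup>n\<close> in absolute value at \<open>m\<close>.
\<close>

lemma map_poly_of_int_mult:
  "map_poly of_int (g * h) = (map_poly of_int g * map_poly of_int h :: 'a::comm_ring_1 poly)"
  by (intro poly_eqI) (simp add: coeff_map_poly coeff_mult)

lemma poly_map_poly_of_int:
  "poly (map_poly of_int g) (of_int x :: 'a::comm_ring_1) = of_int (poly g x)"
  by (induction g) (simp_all add: map_poly_pCons)

lemma ex_int_poly_smult_rat_poly:
  fixes p :: "rat poly"
  shows "\<exists>d g. d > 0 \<and> smult (of_int d) p = map_poly of_int g"
proof (induction p)
  case 0
  show ?case by (intro exI[of _ 1] exI[of _ 0]) simp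
next
  case (pCons a p)
  then obtain d g where d: "d > 0" "smult (of_int d) p = map_poly of_int g"
    by blast
  obtain x y where a: "a = of_int x / of_int y" "y > 0"
    by (metis quotient_of_denom_pos quotient_of_div surj_pair)
  have "smult (of_int (d * y)) (pCons a p) = pCons (of_int (d * x)) (smult (of_int y) (smult (of_int d) p))"
    using a by (simp add: mult.commute)
  also have "\<dots> = map_poly of_int (pCons (d * x) (smult y g))"
    by (simp add: d map_poly_pCons map_poly_smult)
  finally show ?case
    using a d by (intro exI[of _ "d * y"]) auto
qed

text \<open>Gauss's lemma: clearing denominators gives a factorization of an integer multiple of
  \<open>f\<close>. Since primitive parts are multiplicative, those of the two factors give back
  \<open>f\<close> up to its content, which is absorbed into the first factor.\<close>

lemma gauss_rat_factorization:
  fixes f :: "int poly" and G H :: "rat poly"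
  assumes "f \<noteq> 0" "map_poly of_int f = G * H"
  obtains g h where "f = g * h" "degree g = degree G" "degree h = degree H"
proof -
  obtain d g where d: "d > 0" "smult (of_int d) G = map_poly of_int g"
    using ex_int_poly_smult_rat_poly by blast
  obtain e h where e: "e > 0" "smult (of_int e) H = map_poly of_int h"
    using ex_int_poly_smult_rat_poly by blast
  have "map_poly of_int (smult (d * e) f) = (map_poly of_int (g * h) :: rat poly)"
    by (simp add: map_poly_smult map_poly_of_int_mult assms(2) d(2)[symmetric] e(2)[symmetric] mult.commute)
  then have eq: "smult (d * e) f = g * h"
    by (simp add: poly_eq_iff coeff_map_poly del: of_int_mult coeff_smult)
  \<comment> \<open>A scalar changes the primitive part only by its unit factor, that is, its sign;
    so multiplying \<open>f\<close> by the positive \<open>d * e\<close> leaves it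
    unchanged.\<close>
  have "unit_factor (d * e) = 1"
    using d e by simp
  then have "primitive_part f = primitive_part g * primitive_part h"
    using arg_cong[OF eq, of primitive_part] by (simp add: primitive_part_smult primitive_part_mult)
  then have "f = smult (content f) (primitive_part g) * primitive_part h"
    by (metis content_times_primitive_part mult_smult_left)
  moreover have "content f \<noteq> 0"
    using assms(1) by simp
  moreover have "degree g = degree G"
    using d(1) arg_cong[OF d(2), of degree] by (simp add: degree_map_poly split: if_splits)
  moreover have "degree h = degree H"
    using e(1) arg_cong[OF e(2), of degree] by (simp add: degree_map_poly split: if_splits)
  ultimately show ?thesis
    by (intro that[of "smult (content f) (primitive_part g)" "primitive_part h"]) simp_all
qed

text \<open>Non-zero constants are units over the rationals, so the content of \<open>f\<close> does
  not matter and only splittings into two non-constant integer factors have to be excluded.\<close>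

lemma irreducible_map_poly_rat_of_int:
  fixes f :: "int poly"
  assumes "degree f > 0" and "\<And>g h. f = g * h \<Longrightarrow> degree g = 0 \<or> degree h = 0"
  shows "irreducible (map_poly of_int f :: rat poly)"
proof (rule irreducibleI)
  have deg: "degree (map_poly of_int f :: rat poly) > 0"
    using assms(1) by (simp add: degree_map_poly)
  then show nz: "(map_poly of_int f :: rat poly) \<noteq> 0"
    by auto
  show "\<not> is_unit (map_poly of_int f :: rat poly)"
    using deg nz by (simp add: is_unit_iff_degree)
  fix G H :: "rat poly" assume GH: "map_poly of_int f = G * H"
  have "f \<noteq> 0" using assms(1) by auto
  then obtain g h where "f = g * h" "degree g = degree G" "degree h = degree H"
    using gauss_rat_factorization GH by blast
  then have "degree G = 0 \<or> degree H = 0"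
    using assms(2)[of g h] by simp
  moreover have "G \<noteq> 0" "H \<noteq> 0"
    using GH nz by auto
  ultimately show "is_unit G \<or> is_unit H"
    by (simp add: is_unit_iff_degree)
qed

lemma rat_root_of_degree_1:
  fixes g :: "int poly"
  assumes "degree g = 1"
  obtains x :: rat where "poly (map_poly of_int g) x = 0"
proof -
  obtain a b where "g = [:a, b:]" "b \<noteq> 0"
    using assms by (metis One_nat_def degree_eq_zeroE degree_pCons_eq_if lead_coeff_pCons(1)
        leading_coeff_0_iff nat.inject pCons_cases pCons_eq_0_iff zero_neq_one)
  then have "poly (map_poly of_int g) (- of_int a / of_int b :: rat) = 0"
    by (simp add: map_poly_pCons)
  then show ?thesis using that by blast
qed

text \<open>Law of cosines in the triangle with corners \<open>v\<close>, \<open>x\<close> and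
  \<open>z\<close>: outside the sector the angle at \<open>v\<close> is at least \<theta>, and the
  distance from \<open>x\<close> to the ray at angle \<theta> is
  \<open>(x - v) * sin \<theta>\<close>.\<close>

lemma dist_outside_open_sector:
  fixes z :: complex
  assumes "0 < \<theta>" "\<theta> \<le> pi / 2" "v < x" "z \<notin> open_sector v \<theta>"
  shows "(x - v) * sin \<theta> \<le> cmod (of_real x - z)"
proof -
  define w where "w = z - of_real v"
  define M where "M = x - v"
  define \<rho> where "\<rho> = cmod w"
  define \<phi> where "\<phi> = Arg w"
  have w: "w = of_real \<rho> * exp (\<i> * of_real \<phi>)"
    using rcis_cmod_Arg[of w] by (simp add: rcis_def cis_conv_exp \<rho>_def \<phi>_def)
  have M: "M > 0" using assms by (simp add: M_def)
  have "M\<^sup>2 * (sin \<theta>)\<^sup>2 \<le> \<rho>\<^sup>2 - 2 * \<rho> * M * cos \<phi> + M\<^sup>2"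
  proof (cases "\<rho> = 0")
    \<comment> \<open>Here \<open>z\<close> is the vertex \<open>v\<close>, where the argument
      carries no information; the bound follows from \<open>sin \<theta>\<close> having absolute
      value at most 1.\<close>
    case True
    then show ?thesis by (simp add: abs_square_le_1 mult_left_le)
  next
    case False
    have "\<theta> \<le> \<bar>\<phi>\<bar>"
    proof (rule ccontr)
      assume "\<not> \<theta> \<le> \<bar>\<phi>\<bar>"
      moreover have "z = of_real v + of_real \<rho> * exp (\<i> * of_real \<phi>)"
        by (subst w [symmetric]) (simp add: w_def)
      moreover have "\<rho> > 0" using False by (simp add: \<rho>_def)
      ultimately have "z \<in> open_sector v \<theta>"
        unfolding open_sector_def by force
      then show False using assms by simp
    qed
    moreover have "\<bar>\<phi>\<bar> \<le> pi"
      using Arg_bounded[of w] by (simp add: \<phi>_def abs_le_iff)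
    ultimately have "cos \<bar>\<phi>\<bar> \<le> cos \<theta>"
      using assms by (intro cos_monotone_0_pi_le) auto
    then have "\<rho> * M * cos \<phi> \<le> \<rho> * M * cos \<theta>"
      using M by (intro mult_left_mono) (auto simp: \<rho>_def)
    \<comment> \<open>Completing the square in \<rho>: what is left over is
      \<open>M\<^sup>2 - M\<^sup>2 * (cos \<theta>)\<^sup>2\<close>.\<close>
    moreover have "0 \<le> (\<rho> - M * cos \<theta>)\<^sup>2"
      by simp
    moreover have "M\<^sup>2 * (sin \<theta>)\<^sup>2 = M\<^sup>2 - M\<^sup>2 * (cos \<theta>)\<^sup>2"
      by (simp add: sin_squared_eq right_diff_distrib)
    ultimately show ?thesis
      by (simp add: power2_diff power_mult_distrib)
  qed
  also have "\<dots> = (M - \<rho> * cos \<phi>)\<^sup>2 + (\<rho> * sin \<phi>)\<^sup>2"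
    by (simp add: power2_diff power_mult_distrib sin_squared_eq algebra_simps)
  also have "\<dots> = (cmod (of_real M - w))\<^sup>2"
    by (subst w) (simp add: cmod_power2 flip: cis_conv_exp)
  also have "of_real M - w = of_real x - z"
    by (simp add: M_def w_def)
  finally have "(M * sin \<theta>)\<^sup>2 \<le> (cmod (of_real x - z))\<^sup>2"
    by (simp add: power_mult_distrib)
  then show ?thesis
    unfolding M_def by (rule power2_le_imp_le) simp
qed

text \<open>Over the complex numbers \<open>P\<close> splits into linear factors, and each of them
  has absolute value at least \<open>c\<close> at \<open>x\<close>.\<close>

lemma norm_poly_ge_root_distance_power:
  fixes P :: "complex poly"
  assumes "c \<ge> 0" "\<And>z. P \<noteq> 0 \<Longrightarrow> poly P z = 0 \<Longrightarrow> c \<le> cmod (x - z)"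
  shows "cmod (lead_coeff P) * c ^ degree P \<le> cmod (poly P x)"
proof (cases "P = 0")
  case False
  obtain root where root: "smult (lead_coeff P) (\<Prod>i<degree P. [:-root i, 1:]) = P"
    by (rule complex_poly_decompose')
  have poly: "poly P y = lead_coeff P * (\<Prod>i<degree P. y - root i)" for y
    by (subst (1) root [symmetric]) (simp add: poly_prod)
  have "c \<le> cmod (x - root i)" if "i < degree P" for i
    using that assms(2) False by (auto simp: poly)
  then have "(\<Prod>i<degree P. c) \<le> (\<Prod>i<degree P. cmod (x - root i))"
    using assms(1) by (intro prod_mono) auto
  then show ?thesis
    by (simp add: poly norm_mult prod_norm mult_left_mono)
qed auto

lemma int_poly_ge_root_distance_power:
  fixes g :: "int poly"
  assumes "c \<ge> 0" "g \<noteq> 0"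
    and "\<And>z::complex. poly (map_poly of_int g) z = 0 \<Longrightarrow> c \<le> cmod (of_int x - z)"
  shows "c ^ degree g \<le> \<bar>of_int (poly g x)\<bar>"
proof -
  let ?P = "map_poly of_int g :: complex poly"
  have "1 \<le> \<bar>lead_coeff g\<bar>"
    using assms(2) by (simp add: int_one_le_iff_zero_less)
  then have "1 \<le> cmod (lead_coeff ?P)"
    by (simp add: coeff_map_poly degree_map_poly flip: of_int_abs)
  then have "c ^ degree g \<le> cmod (lead_coeff ?P) * c ^ degree g"
    using assms(1) by (simp add: mult_le_cancel_right1)
  also have "\<dots> = cmod (lead_coeff ?P) * c ^ degree ?P"
    by (simp add: degree_map_poly)
  also have "\<dots> \<le> cmod (poly ?P (of_int x))"
    using assms by (intro norm_poly_ge_root_distance_power) auto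
  finally show ?thesis
    by (simp add: poly_map_poly_of_int)
qed

text \<open>\<open>A\<close> and \<open>B\<close> are the values of two factors at a point and
  \<open>A'\<close>, \<open>B'\<close> those of their derivatives, so that
  \<open>A' * B + A * B'\<close> is the product rule. The part of \<open>A\<close> prime to
  \<open>p\<close> divides \<open>q\<close>, and the exponent of \<open>p\<close> in
  \<open>A\<close> is bounded by both \<open>l\<close> and \<open>k / 2\<close>.\<close>

lemma factor_bound_by_multiplicity:
  fixes A B A' B' :: int
  assumes p: "prime p" and "q > 0" "\<not> p dvd q" "\<not> p dvd r"
    and AB: "A * B = int (p ^ k * q)" and D: "\<bar>A' * B + A * B'\<bar> = int (p ^ l * r)"
    and le: "multiplicity (int p) A \<le> multiplicity (int p) B"
  shows "of_int \<bar>A\<bar> \<le> real p powr (min (real l) (real k / 2)) * real q"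
proof -
  define P where "P = int p"
  define a where "a = multiplicity P A"
  have P: "prime P" using p by (simp add: P_def)
  have p1: "real p \<ge> 1" using prime_ge_1_nat[OF p] by simp
  have mult: "multiplicity P (int (p ^ n * t)) = n" if "\<not> p dvd t" for n t
    using that P by (intro multiplicity_decomposeI[of _ _ _ "int t"]) (auto simp: P_def)
  have nz: "A \<noteq> 0" "B \<noteq> 0"
    using AB \<open>q > 0\<close> prime_gt_0_nat[OF p] by auto
  have "a + multiplicity P B = k"
    using prime_elem_multiplicity_mult_distrib[of P A B] prime_imp_prime_elem[OF P] nz
      mult[OF assms(3), of k] unfolding AB a_def by simp
  then have a2: "2 * a \<le> k"
    using le by (simp add: a_def P_def)
  have "P ^ a dvd A" "P ^ a dvd B"
    using le by (auto simp: a_def P_def multiplicity_dvd multiplicity_dvd')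
  then have "P ^ a dvd \<bar>A' * B + A * B'\<bar>"
    by (simp add: dvd_add)
  then have "P ^ a dvd int (p ^ l * r)"
    using D by simp
  \<comment> \<open>Divisibility by \<open>P ^ a\<close> bounds \<open>a\<close> only for a non-zero
    number; \<open>r\<close> is non-zero because \<open>p\<close> does not divide it.\<close>
  moreover have "int (p ^ l * r) \<noteq> 0"
    using assms(4) prime_gt_0_nat[OF p] by (cases "r = 0") auto
  ultimately have al: "a \<le> l"
    using mult[of r l] assms(4) P
    by (metis not_prime_unit power_dvd_iff_le_multiplicity)
  obtain A0 where A0: "A = P ^ a * A0" "\<not> P dvd A0"
    using multiplicity_decompose'[of A P] nz P unfolding a_def by (metis not_prime_unit)
  have "A0 dvd P ^ k * int q"
    using A0 AB by (metis P_def dvd_mult_left dvd_triv_left dvd_triv_right of_nat_mult of_nat_power dvd_trans)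
  moreover have "coprime A0 (P ^ k)"
    using A0 P by (metis coprime_commute coprime_power_left_iff prime_imp_coprime)
  ultimately have "A0 dvd int q"
    by (simp add: coprime_dvd_mult_right_iff)
  then have "\<bar>A0\<bar> \<le> int q"
    using \<open>q > 0\<close> by (intro zdvd_imp_le) auto
  then have "of_int \<bar>A0\<bar> \<le> real q"
    by linarith
  moreover have "real p ^ a \<le> real p powr (min (real l) (real k / 2))"
  proof -
    have "real p ^ a = real p powr real a"
      using p1 by (simp add: powr_realpow)
    also have "\<dots> \<le> real p powr (min (real l) (real k / 2))"
      using p1 al a2 by (intro powr_mono) auto
    finally show ?thesis .
  qed
  moreover have "of_int \<bar>A\<bar> = real p ^ a * of_int \<bar>A0\<bar>"
    by (simp add: A0 P_def abs_mult power_abs)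
  ultimately show ?thesis
    by (simp add: mult_mono)
qed

theorem theorem3p9:
  fixes f :: "int poly" and v \<theta> s :: real and p k q r m l :: nat
  assumes "degree f > 0"
    and "0 < \<theta>" and "\<theta> \<le> pi / 2"
    and "\<forall>z \<in> open_sector v \<theta>. poly (map_poly of_int f) z \<noteq> 0"
    and "prime p"
    and "k > 0" and "q > 0" and "r > 0" and "m > 0"
    and "poly f (int m) = int (p ^ k * q)"
    and "poly (pderiv f) (int m) = int (p ^ l * r) \<or> poly (pderiv f) (int m) = - int (p ^ l * r)"
    and "\<not> p dvd q * r"
    and "s = min (real l) (real k / 2)"
  shows "(real m > v + real p powr s * real q / sin \<theta>
            \<longrightarrow> irreducible (map_poly of_int f :: rat poly)) \<and>
         ((\<forall>x::rat. poly (map_poly of_int f) x \<noteq> 0) \<and>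
          real m > v + sqrt (real p powr s * real q) / sin \<theta>
            \<longrightarrow> irreducible (map_poly of_int f :: rat poly))"
proof -
  \<comment> \<open>When positive, \<open>c\<close> bounds from below the distance from
    \<open>m\<close> to every complex root of \<open>f\<close>. The two hypotheses on
    \<open>m\<close> amount to \<open>K < c\<close> and \<open>sqrt K < c\<close>.\<close>
  define c where "c = (real m - v) * sin \<theta>"
  define K where "K = real p powr s * real q"
  have sin: "sin \<theta> > 0"
    using assms(2,3) by (intro sin_gt_zero) auto
  have "real p \<ge> 1" "s \<ge> 0"
    using prime_ge_1_nat[OF assms(5)] assms(13) by auto
  \<comment> \<open>This yields \<open>1 \<le> c\<close> in both cases, so that powers of
    \<open>c\<close> grow with the exponent.\<close>
  then have "1 * 1 \<le> K"
    unfolding K_def using assms(7) by (intro mult_mono ge_one_powr_ge_zero) auto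
  then have K: "1 \<le> K" by simp
  have nd: "\<not> p dvd q" "\<not> p dvd r"
    using assms(12) by auto
  have f0: "f \<noteq> 0" using assms(1) by auto
  have D: "\<bar>poly (pderiv f) (int m)\<bar> = int (p ^ l * r)"
    using assms(11) by (metis abs_minus_cancel abs_of_nat)
  have c_pow_le: "c ^ degree g \<le> \<bar>of_int (poly g (int m))\<bar>" if "g dvd f" "c > 0" for g
  proof (rule int_poly_ge_root_distance_power)
    fix z :: complex assume "poly (map_poly of_int g) z = 0"
    then have "poly (map_poly of_int f) z = 0"
      using \<open>g dvd f\<close> by (auto simp: map_poly_of_int_mult)
    then have "z \<notin> open_sector v \<theta>" using assms(4) by auto
    moreover have "v < real m"
      using \<open>c > 0\<close> sin by (simp add: c_def zero_less_mult_iff)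
    ultimately show "c \<le> cmod (of_int (int m) - z)"
      using dist_outside_open_sector[of \<theta> v "real m" z] assms(2,3) by (simp add: c_def)
  qed (use f0 that in auto)
  have small: "\<exists>d\<in>{g, h}. of_int \<bar>poly d (int m)\<bar> \<le> K" if "f = g * h" for g h
  proof -
    have eqs: "poly g (int m) * poly h (int m) = int (p ^ k * q)"
      "\<bar>poly (pderiv g) (int m) * poly h (int m) + poly g (int m) * poly (pderiv h) (int m)\<bar> = int (p ^ l * r)"
      using assms(10) D by (simp_all add: that pderiv_mult algebra_simps)
    \<comment> \<open>The bound applies to the value with the smaller exponent of \<open>p\<close>,
      which may belong to either factor, so both orders are prepared.\<close>
    have eqs': "poly h (int m) * poly g (int m) = int (p ^ k * q)"
      "\<bar>poly (pderiv h) (int m) * poly g (int m) + poly h (int m) * poly (pderiv g) (int m)\<bar> = int (p ^ l * r)"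
      using eqs by (simp_all add: algebra_simps)
    show ?thesis
      using factor_bound_by_multiplicity[OF assms(5,7) nd eqs]
        factor_bound_by_multiplicity[OF assms(5,7) nd eqs']
      by (fastforce simp: K_def assms(13))
  qed
  \<comment> \<open>Both claims at once: \<open>n\<close> is a lower bound for the degrees of
    non-constant divisors, 1 in general and 2 in the absence of rational roots. A non-constant
    factor with value at most \<open>K\<close> would give \<open>c ^ n \<le> K\<close>.\<close>
  have irred: "irreducible (map_poly of_int f :: rat poly)"
    if "c \<ge> 1" "K < c ^ n" "\<And>g. g dvd f \<Longrightarrow> degree g > 0 \<Longrightarrow> n \<le> degree g" for n
  proof (rule irreducible_map_poly_rat_of_int)
    fix g h assume gh: "f = g * h"
    obtain d where d: "d \<in> {g, h}" "of_int \<bar>poly d (int m)\<bar> \<le> K"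
      using small[OF gh] by blast
    have "degree d = 0"
    proof (rule ccontr)
      assume "degree d \<noteq> 0"
      moreover have "d dvd f" using d gh by auto
      ultimately have "c ^ n \<le> c ^ degree d"
        using that by (intro power_increasing) auto
      also have "\<dots> \<le> K"
        using c_pow_le[OF \<open>d dvd f\<close>] d(2) that(1) by simp
      finally show False using that(2) by simp
    qed
    then show "degree g = 0 \<or> degree h = 0" using d by auto
  qed (fact assms(1))
  show ?thesis
  proof (intro conjI impI; (elim conjE)?)
    assume "real m > v + real p powr s * real q / sin \<theta>"
    then have "K < c"
      using sin by (simp add: c_def K_def field_simps)
    then show "irreducible (map_poly of_int f :: rat poly)"
      using K by (intro irred[of 1]) auto
  next
    assume no_root: "\<forall>x::rat. poly (map_poly of_int f) x \<noteq> 0"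
      and "real m > v + sqrt (real p powr s * real q) / sin \<theta>"
    then have c: "sqrt K < c"
      using sin by (simp add: c_def K_def field_simps)
    have "1 \<le> sqrt K" using K by simp
    then have "1 \<le> c" using c by linarith
    moreover have "K < c\<^sup>2"
    proof -
      have "(sqrt K)\<^sup>2 < c\<^sup>2"
        using c K by (intro power_strict_mono) auto
      then show ?thesis using K by simp
    qed
    \<comment> \<open>A divisor of degree 1 would contribute a rational root of
      \<open>f\<close>.\<close>
    moreover have "2 \<le> degree g" if "g dvd f" "degree g > 0" for g
    proof (rule ccontr)
      assume "\<not> 2 \<le> degree g"
      then have "degree g = 1" using that by simp
      then obtain x :: rat where "poly (map_poly of_int g) x = 0"
        by (rule rat_root_of_degree_1)
      then show False
        using no_root \<open>g dvd f\<close> by (auto simp: map_poly_of_int_mult)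
    qed
    ultimately show "irreducible (map_poly of_int f :: rat poly)"
      by (intro irred[of 2]) auto
  qed
qed

end
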